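(* Let $\widehat{X}$ be a sandpile graph and let $a\in\mathcal{M}(\widehat{X})$. If every vertex of every cycle of $X$ lies in $\operatorname{cl}(\operatorname{supp}(a))$ (i.e., $\iota(\operatorname{supp}(a))$ contains every cycle of $X$), then the sequence $a,\ a\oplus a,\ a\oplus a\oplus a,\dots$ eventually reaches a recurrent configuration. Conversely, if some cycle of $X$ is not contained in $\iota(\operatorname{supp}(a))$, then no term of this sequence is recurrent.
   Context: A sandpile graph $\widehat{X}$ is a finite weakly connected directed multigraph (loops and multiple edges allowed) with a distinguished vertex, the sink, reachable by a directed path from every vertex; the set $V$ of non-sink vertices is nonempty, and $X$ is the digraph obtained by deleting the sink. A configuration assigns a nonnegative integer number of grains to each non-sink vertex; it is stable if every $v$ holds fewer than $\deg^{+}(v)$ (out-degree) grains. Toppling an unstable vertex sends one grain along each of its out-edges (grains at the sink vanish; the sink never topples); every configuration has a unique stabilization. $\mathcal{M}(\widehat X)$ is the set of stable configurations with $a\oplus b$ = stabilization of $a+b$. $a$ is accessible from $b$ if $b\oplus x=a$ for some $x$; $a$ is recurrent if accessible from every element. $\operatorname{supp}(a)$ is the set of vertices holding at least one grain. A cycle is a directed closed path of length $\ge1$ in $X$. For $W\subseteq V$, $\operatorname{cl}(W)$ is the set of $z\in V$ reachable by a (possibly trivial) directed path in $X$ from some $w\in W$, and $\iota(W)$ is the subgraph of $\widehat X$ induced on $\operatorname{cl}(W)\cup\{\text{sink}\}$ (edges of $\widehat X$ with tail in $\operatorname{cl}(W)$). *)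

theory Defs
  imports "Graph_Theory.Graph_Theory"
begin

text \<open>
  Arcs of a \<^typ>\<open>('v, 'e) pre_digraph\<close> are abstract objects with a tail and a head, so loops and
  multiple edges are allowed. The library predicate \<^const>\<open>connected\<close> is weak connectedness.
  The sink may have outgoing arcs; they play no role, since the sink never topples.
\<close>

locale sandpile_graph = fin_digraph G for G :: "('v, 'e) pre_digraph" +
  fixes s :: 'v
  assumes sink_in_verts: "s \<in> verts G"
    and weakly_connected: "connected G"
    and sink_reachable: "\<And>v. v \<in> verts G \<Longrightarrow> v \<rightarrow>\<^sup>*\<^bsub>G\<^esub> s"
    and nonsink_nonempty: "verts G - {s} \<noteq> {}"

definition nonsink :: "('v, 'e) pre_digraph \<Rightarrow> 'v \<Rightarrow> 'v set" where
  "nonsink G s = verts G - {s}"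

abbreviation sinkless :: "('v, 'e) pre_digraph \<Rightarrow> 'v \<Rightarrow> ('v, 'e) pre_digraph" where
  "sinkless G s \<equiv> pre_digraph.del_vert G s"

text \<open>
  Configurations are total functions that vanish off the non-sink vertices, so that equality of
  configurations is equality of functions.
\<close>

definition config :: "('v, 'e) pre_digraph \<Rightarrow> 'v \<Rightarrow> ('v \<Rightarrow> nat) \<Rightarrow> bool" where
  "config G s c \<longleftrightarrow> (\<forall>v. v \<notin> nonsink G s \<longrightarrow> c v = 0)"

definition stable :: "('v, 'e) pre_digraph \<Rightarrow> 'v \<Rightarrow> ('v \<Rightarrow> nat) \<Rightarrow> bool" where
  "stable G s c \<longleftrightarrow> (\<forall>v \<in> nonsink G s. c v < out_degree G v)"

text \<open>
  A loop at \<open>v\<close> counts towards the out-degree of \<open>v\<close>, and the grain sent along it returns to \<open>v\<close>.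
  The truncated subtraction is only used when \<open>v\<close> holds at least out-degree many grains.
\<close>

definition topple :: "('v, 'e) pre_digraph \<Rightarrow> 'v \<Rightarrow> 'v \<Rightarrow> ('v \<Rightarrow> nat) \<Rightarrow> ('v \<Rightarrow> nat)" where
  "topple G s v c = (\<lambda>w. if w \<in> nonsink G s
     then (if w = v then c w - out_degree G v else c w) + card {e \<in> out_arcs G v. head G e = w}
     else 0)"

definition topples :: "('v, 'e) pre_digraph \<Rightarrow> 'v \<Rightarrow> ('v \<Rightarrow> nat) \<Rightarrow> ('v \<Rightarrow> nat) \<Rightarrow> bool" where
  "topples G s c c' \<longleftrightarrow> (\<exists>v \<in> nonsink G s. out_degree G v \<le> c v \<and> c' = topple G s v c)"

definition stabilization :: "('v, 'e) pre_digraph \<Rightarrow> 'v \<Rightarrow> ('v \<Rightarrow> nat) \<Rightarrow> ('v \<Rightarrow> nat)" where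
  "stabilization G s c = (THE c'. (topples G s)\<^sup>*\<^sup>* c c' \<and> stable G s c')"

definition sandpile_monoid :: "('v, 'e) pre_digraph \<Rightarrow> 'v \<Rightarrow> ('v \<Rightarrow> nat) set" where
  "sandpile_monoid G s = {c. config G s c \<and> stable G s c}"

definition sp_add :: "('v, 'e) pre_digraph \<Rightarrow> 'v \<Rightarrow> ('v \<Rightarrow> nat) \<Rightarrow> ('v \<Rightarrow> nat) \<Rightarrow> ('v \<Rightarrow> nat)" where
  "sp_add G s a b = stabilization G s (\<lambda>v. a v + b v)"

definition accessible :: "('v, 'e) pre_digraph \<Rightarrow> 'v \<Rightarrow> ('v \<Rightarrow> nat) \<Rightarrow> ('v \<Rightarrow> nat) \<Rightarrow> bool" where
  "accessible G s a b \<longleftrightarrow> (\<exists>x \<in> sandpile_monoid G s. sp_add G s b x = a)"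

definition recurrent :: "('v, 'e) pre_digraph \<Rightarrow> 'v \<Rightarrow> ('v \<Rightarrow> nat) \<Rightarrow> bool" where
  "recurrent G s a \<longleftrightarrow>
     a \<in> sandpile_monoid G s \<and> (\<forall>b \<in> sandpile_monoid G s. accessible G s a b)"

definition supp :: "('v, 'e) pre_digraph \<Rightarrow> 'v \<Rightarrow> ('v \<Rightarrow> nat) \<Rightarrow> 'v set" where
  "supp G s a = {v \<in> nonsink G s. 1 \<le> a v}"

definition cl :: "('v, 'e) pre_digraph \<Rightarrow> 'v \<Rightarrow> 'v set \<Rightarrow> 'v set" where
  "cl G s W = {z \<in> nonsink G s. \<exists>w \<in> W. w \<rightarrow>\<^sup>*\<^bsub>sinkless G s\<^esub> z}"

text \<open>
  Only arcs with tail in the closure are kept: unlike in \<^const>\<open>induce_subgraph\<close>, arcs leaving the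
  sink are dropped.
\<close>

definition iota :: "('v, 'e) pre_digraph \<Rightarrow> 'v \<Rightarrow> 'v set \<Rightarrow> ('v, 'e) pre_digraph" where
  "iota G s W = \<lparr> verts = cl G s W \<union> {s}, arcs = {e \<in> arcs G. tail G e \<in> cl G s W},
     tail = tail G, head = head G \<rparr>"

text \<open>
  A cycle is given by the list of its arcs. The library notion \<^const>\<open>pre_digraph.cycle\<close> is a
  closed directed path with at least one arc; a single loop is a cycle.
\<close>

definition cycle_verts :: "('v, 'e) pre_digraph \<Rightarrow> 'e list \<Rightarrow> 'v set" where
  "cycle_verts G p = tail G ` set p \<union> head G ` set p"

definition contains_cycle ::
    "('v, 'e) pre_digraph \<Rightarrow> ('v, 'e) pre_digraph \<Rightarrow> 'e list \<Rightarrow> bool" where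
  "contains_cycle H G p \<longleftrightarrow> set p \<subseteq> arcs H \<and> cycle_verts G p \<subseteq> verts H"

text \<open>The term with index \<open>n\<close> is the sum of \<open>n + 1\<close> copies of \<open>a\<close>; the sequence starts with \<open>a\<close>.\<close>

primrec multiples :: "('v, 'e) pre_digraph \<Rightarrow> 'v \<Rightarrow> ('v \<Rightarrow> nat) \<Rightarrow> nat \<Rightarrow> ('v \<Rightarrow> nat)" where
  "multiples G s a 0 = a"
| "multiples G s a (Suc n) = sp_add G s (multiples G s a n) a"

lemma (in sandpile_graph) iota_contains_cycle_iff:
  assumes "pre_digraph.cycle (sinkless G s) p"
  shows "contains_cycle (iota G s W) (sinkless G s) p \<longleftrightarrow>
    cycle_verts (sinkless G s) p \<subseteq> cl G s W"
proof -
  have sub: "set p \<subseteq> arcs (sinkless G s)"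
    using assms unfolding pre_digraph.cycle_def pre_digraph.awalk_def by auto
  then show ?thesis
    by (auto simp: contains_cycle_def iota_def cycle_verts_def pre_digraph.del_vert_def)
qed

end

theory Submission
  imports Defs
begin

text \<open>
  Forward direction: some multiple \<open>e\<close> of \<open>a\<close> is idempotent. The configurations that divide \<open>e\<close>
  are then closed under sums, under passing to smaller configurations, and under toppling in
  both directions. Starting from \<open>a\<close>, single grains on all of \<open>cl (supp a)\<close> divide \<open>e\<close>. The
  remaining vertices carry no cycle, and induction from successors to predecessors shows that a
  grain on any of them divides \<open>e\<close> too, since out-degree many grains on a vertex topple to single
  grains on its successors. So every configuration divides \<open>e\<close>.

  Converse: a grain on a vertex that reaches a given cycle can never leave the set of such vertices
  without leaving another grain there. If the cycle avoids \<open>cl (supp a)\<close>, this set does too,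
  while all multiples of \<open>a\<close> vanish off \<open>cl (supp a)\<close>.
\<close>

section \<open>Cycles in terms of reachability\<close>

lemma (in wf_digraph) reachable1_first_step:
  assumes "u \<rightarrow>\<^sup>+ v"
  obtains w where "u \<rightarrow> w" "w \<rightarrow>\<^sup>* v"
  using tranclD[OF assms] by (auto simp: reachable_conv' adj_in_verts)

text \<open>Trades arc lists for reachability: an arc out of \<open>v\<close> followed by a simple
  path back to \<open>v\<close> is a cycle, and every vertex of a cycle reaches its base point and
  is reached from it.\<close>

lemma (in wf_digraph) reachable1_self_iff_cycle:
  "v \<rightarrow>\<^sup>+ v \<longleftrightarrow> (\<exists>p. cycle p \<and> v \<in> cycle_verts G p)"
proof
  assume "v \<rightarrow>\<^sup>+ v"
  then obtain w where vw: "v \<rightarrow> w" and wv: "w \<rightarrow>\<^sup>* v"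
    by (rule reachable1_first_step)
  from vw obtain e where e: "e \<in> arcs G" "tail G e = v" "head G e = w" by auto
  from wv obtain q where q: "apath w q v" by (auto simp: reachable_apath)
  have "awalk v (e # q) v" "distinct (tl (awalk_verts v (e # q)))"
    using e q by (auto simp: apath_def awalk_Cons_iff)
  then have "cycle (e # q)" unfolding cycle_def by blast
  moreover have "v \<in> cycle_verts G (e # q)" using e by (auto simp: cycle_verts_def)
  ultimately show "\<exists>p. cycle p \<and> v \<in> cycle_verts G p" by blast
next
  assume "\<exists>p. cycle p \<and> v \<in> cycle_verts G p"
  then obtain p u where p: "awalk u p u" "p \<noteq> []" and v: "v \<in> cycle_verts G p"
    unfolding cycle_def by blast
  have cas: "cas u p u" using p by (simp add: awalk_def)
  have "v \<in> set (awalk_verts u p)"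
  proof (cases "v \<in> head G ` set p")
    case True
    then show ?thesis unfolding awalk_verts_conv'[OF cas] using p(2) by auto
  next
    case False
    then show ?thesis using v p(2) unfolding cycle_verts_def awalk_verts_conv by auto
  qed
  then have "u \<rightarrow>\<^sup>* v" "v \<rightarrow>\<^sup>* u"
    using awalk_verts_reachable_from awalk_verts_reachable_to p by blast+
  moreover have "u \<rightarrow>\<^sup>+ u" using reachable1_awalk p by blast
  ultimately show "v \<rightarrow>\<^sup>+ v"
    by (meson reachable1_reachable_trans reachable_reachable1_trans)
qed

text \<open>The piles \<open>pile v 1\<close> on non-sink vertices generate all configurations under
  addition, so divisibility can be checked grain by grain.\<close>

definition pile :: "'v \<Rightarrow> nat \<Rightarrow> 'v \<Rightarrow> nat" where
  "pile v k = (\<lambda>w. if w = v then k else 0)"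

context sandpile_graph
begin

abbreviation mult :: "'v \<Rightarrow> 'v \<Rightarrow> nat" where
  "mult v w \<equiv> card {e \<in> out_arcs G v. head G e = w}"

lemma finite_nonsink: "finite (nonsink G s)"
  by (simp add: nonsink_def)

lemma mult_pos_iff: "0 < mult v w \<longleftrightarrow> (\<exists>e \<in> arcs G. tail G e = v \<and> head G e = w)"
  by (auto simp: card_gt_0_iff out_arcs_def)

lemma nonsink_eq_verts_sinkless: "nonsink G s = verts (sinkless G s)"
  by (simp add: nonsink_def verts_del_vert)

lemma dominates_sinkless_iff:
  "v \<rightarrow>\<^bsub>sinkless G s\<^esub> w \<longleftrightarrow> v \<in> nonsink G s \<and> w \<in> nonsink G s \<and> 0 < mult v w"
  unfolding mult_pos_iff arcs_ends_conv nonsink_def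
  by (auto simp: del_vert_simps image_iff)

interpretation X: fin_digraph "sinkless G s"
  by (rule fin_digraph_del_vert)

subsection \<open>Stabilization\<close>

text \<open>Take the length of a shortest walk to the sink; the first arc of such a walk leads
  closer to it.\<close>

lemma sink_distance_exists:
  "\<exists>d :: 'v \<Rightarrow> nat. d s = 0 \<and> (\<forall>v \<in> nonsink G s. \<exists>e \<in> out_arcs G v. d (head G e) < d v)"
proof -
  define d where "d v = (LEAST n. (v, s) \<in> arcs_ends G ^^ n)" for v
  have d_le: "d v \<le> n" if "(v, s) \<in> arcs_ends G ^^ n" for v n
    unfolding d_def using that by (rule Least_le)
  have "\<exists>e \<in> out_arcs G v. d (head G e) < d v" if v: "v \<in> nonsink G s" for v
  proof -
    have "v \<rightarrow>\<^sup>*\<^bsub>G\<^esub> s" using v sink_reachable by (auto simp: nonsink_def)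
    then have "\<exists>n. (v, s) \<in> arcs_ends G ^^ n"
      by (meson reachable_rtranclI rtrancl_imp_relpow)
    then have dv: "(v, s) \<in> arcs_ends G ^^ d v"
      unfolding d_def by (rule LeastI_ex)
    have "v \<noteq> s" using v by (simp add: nonsink_def)
    then obtain m where m: "d v = Suc m" using dv by (cases "d v") auto
    then obtain u where u: "v \<rightarrow>\<^bsub>G\<^esub> u" "(u, s) \<in> arcs_ends G ^^ m"
      using dv relpow_Suc_D2 by metis
    obtain e where "e \<in> arcs G" "tail G e = v" "head G e = u" using u(1) by auto
    then show ?thesis using d_le[OF u(2)] m by (auto simp: out_arcs_def intro!: bexI[of _ e])
  qed
  moreover have "d s = 0" using d_le[of s 0] by simp
  ultimately show ?thesis by blast
qed

text \<open>
  With \<open>d\<close> a distance to the sink bounded by \<open>K\<close> and \<open>B\<close> larger than all out-degrees, the weight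
  \<open>B ^ K - B ^ (K - d v)\<close> works: the single out-neighbour of \<open>v\<close> closer to the sink outweighs
  all others.
\<close>

lemma superharmonic_weight_exists:
  "\<exists>h :: 'v \<Rightarrow> nat. h s = 0 \<and>
     (\<forall>v \<in> nonsink G s. (\<Sum>e \<in> out_arcs G v. h (head G e)) < out_degree G v * h v)"
proof -
  obtain d :: "'v \<Rightarrow> nat" where d0: "d s = 0"
    and d: "\<And>v. v \<in> nonsink G s \<Longrightarrow> \<exists>e \<in> out_arcs G v. d (head G e) < d v"
    using sink_distance_exists by blast
  define K where "K = Max (d ` verts G)"
  define B where "B = Suc (card (arcs G))"
  define h where "h v = B ^ K - B ^ (K - d v)" for v
  have K: "d v \<le> K" if "v \<in> verts G" for v
    unfolding K_def using that by auto
  \<comment> \<open>Additive form of the definition, so that no truncated subtraction enters the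
    sums.\<close>
  have h: "h v + B ^ (K - d v) = B ^ K" for v
    unfolding h_def B_def by (simp add: power_increasing)
  have "(\<Sum>e \<in> out_arcs G v. h (head G e)) < out_degree G v * h v" if v: "v \<in> nonsink G s" for v
  proof -
    obtain e where e: "e \<in> out_arcs G v" and lt: "d (head G e) < d v" using d v by blast
    have fin: "finite (out_arcs G v)" by blast
    have dB: "out_degree G v < B"
      unfolding out_degree_def B_def
      by (metis card_mono finite_arcs le_imp_less_Suc mem_Collect_eq out_arcs_def subsetI)
    have "out_degree G v * B ^ (K - d v) < B * B ^ (K - d v)"
      using dB by (intro mult_strict_right_mono) (simp_all add: B_def)
    also have "\<dots> = B ^ Suc (K - d v)" by simp
    also have "\<dots> \<le> B ^ (K - d (head G e))"
      using lt K[of v] v by (intro power_increasing) (auto simp: nonsink_def B_def)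
    also have "\<dots> \<le> (\<Sum>e \<in> out_arcs G v. B ^ (K - d (head G e)))"
      using e fin by (intro member_le_sum) auto
    finally have lt': "out_degree G v * B ^ (K - d v) < (\<Sum>e \<in> out_arcs G v. B ^ (K - d (head G e)))" .
    have "(\<Sum>e \<in> out_arcs G v. h (head G e)) + (\<Sum>e \<in> out_arcs G v. B ^ (K - d (head G e)))
        = out_degree G v * B ^ K"
      by (simp add: sum.distrib[symmetric] h out_degree_def)
    also have "\<dots> = out_degree G v * h v + out_degree G v * B ^ (K - d v)"
      by (simp add: h[of v, symmetric] distrib_left)
    finally show ?thesis using lt' by linarith
  qed
  moreover have "h s = 0" by (simp add: h_def d0)
  ultimately show ?thesis by blast
qed

text \<open>Groups the out-arcs by their heads, matching the arc counts in \<open>topple\<close>;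
  arcs into the sink have weight 0.\<close>

lemma sum_out_arcs_eq_sum_mult:
  fixes h :: "'v \<Rightarrow> nat"
  assumes "h s = 0"
  shows "(\<Sum>e \<in> out_arcs G v. h (head G e)) = (\<Sum>w \<in> nonsink G s. mult v w * h w)"
proof -
  have "(\<Sum>e \<in> out_arcs G v. h (head G e))
      = (\<Sum>w \<in> verts G. \<Sum>e \<in> {e \<in> out_arcs G v. head G e = w}. h (head G e))"
    by (rule sum.group[symmetric]) (auto simp: out_arcs_def)
  also have "\<dots> = (\<Sum>w \<in> verts G. mult v w * h w)" by simp
  also have "\<dots> = (\<Sum>w \<in> nonsink G s. mult v w * h w)"
    using assms by (intro sum.mono_neutral_right) (auto simp: nonsink_def)
  finally show ?thesis .
qed

text \<open>Toppling terminates because the number of grains weighted by a strictly superharmonic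
  \<open>h\<close> drops at each step.\<close>

lemma stabilizes: "\<exists>c'. (topples G s)\<^sup>*\<^sup>* c c' \<and> stable G s c'"
proof -
  obtain h :: "'v \<Rightarrow> nat" where h0: "h s = 0"
    and h: "\<And>v. v \<in> nonsink G s \<Longrightarrow>
      (\<Sum>w \<in> nonsink G s. mult v w * h w) < out_degree G v * h v"
    using superharmonic_weight_exists by (auto simp: sum_out_arcs_eq_sum_mult)
  define \<Phi> where "\<Phi> c = (\<Sum>w \<in> nonsink G s. c w * h w)" for c
  have dec: "\<Phi> c' < \<Phi> c" if step: "topples G s c c'" for c c'
  proof -
    obtain v where v: "v \<in> nonsink G s" and le: "out_degree G v \<le> c v"
      and c': "c' = topple G s v c"
      using step unfolding topples_def by blast
    have "\<Phi> c' + out_degree G v * h v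
        = (\<Sum>w \<in> nonsink G s. c' w * h w + (if w = v then out_degree G v * h v else 0))"
      using v finite_nonsink by (simp add: \<Phi>_def sum.distrib)
    also have "\<dots> = (\<Sum>w \<in> nonsink G s. c w * h w + mult v w * h w)"
      using le by (intro sum.cong) (auto simp: c' topple_def simp flip: distrib_right)
    also have "\<dots> = \<Phi> c + (\<Sum>w \<in> nonsink G s. mult v w * h w)"
      by (simp add: \<Phi>_def sum.distrib)
    finally show ?thesis using h[OF v] by linarith
  qed
  show ?thesis
  proof (induction "\<Phi> c" arbitrary: c rule: less_induct)
    case less
    show ?case
    proof (cases "stable G s c")
      case False
      then obtain v where "v \<in> nonsink G s" "out_degree G v \<le> c v"
        unfolding stable_def by (auto simp: not_less)
      then have step: "topples G s c (topple G s v c)" unfolding topples_def by blast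
      show ?thesis using less[OF dec[OF step]] step by (meson converse_rtranclp_into_rtranclp)
    qed blast
  qed
qed

section \<open>Confluence and uniqueness of the stabilization\<close>

lemma topples_diamond:
  assumes "topples G s c c\<^sub>1" "topples G s c c\<^sub>2" "c\<^sub>1 \<noteq> c\<^sub>2"
  shows "\<exists>d. topples G s c\<^sub>1 d \<and> topples G s c\<^sub>2 d"
proof -
  obtain v w where v: "v \<in> nonsink G s" "out_degree G v \<le> c v" "c\<^sub>1 = topple G s v c"
    and w: "w \<in> nonsink G s" "out_degree G w \<le> c w" "c\<^sub>2 = topple G s w c"
    using assms unfolding topples_def by blast
  have "v \<noteq> w" using assms(3) v w by blast
  then have "topple G s w c\<^sub>1 = topple G s v c\<^sub>2"
    using v w by (auto simp: topple_def fun_eq_iff)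
  moreover have "out_degree G w \<le> c\<^sub>1 w" "out_degree G v \<le> c\<^sub>2 v"
    using v w \<open>v \<noteq> w\<close> by (auto simp: topple_def)
  then have "topples G s c\<^sub>1 (topple G s w c\<^sub>1)" "topples G s c\<^sub>2 (topple G s v c\<^sub>2)"
    unfolding topples_def using v w by blast+
  ultimately show ?thesis by auto
qed

lemma stable_no_topple: "stable G s c \<Longrightarrow> \<not> topples G s c c'"
  unfolding stable_def topples_def by (auto simp: not_le)

lemma stable_rtranclp_topples: "(topples G s)\<^sup>*\<^sup>* c c' \<Longrightarrow> stable G s c \<Longrightarrow> c' = c"
  by (metis converse_rtranclpE stable_no_topple)

lemma topples_stable_confluent:
  assumes "(topples G s)\<^sup>*\<^sup>* c x" "stable G s x" "(topples G s)\<^sup>*\<^sup>* c y"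
  shows "(topples G s)\<^sup>*\<^sup>* y x"
proof -
  \<comment> \<open>A single toppling from \<open>c\<close> cannot lose \<open>x\<close>: either it
    is the first one on the given way to \<open>x\<close>, or the diamond carries it one step along
    that way.\<close>
  have one: "(topples G s)\<^sup>*\<^sup>* y x" if "(topples G s)\<^sup>*\<^sup>* c x" "topples G s c y" for c y
    using that
  proof (induction arbitrary: y rule: converse_rtranclp_induct)
    case base
    then show ?case using assms(2) stable_no_topple by blast
  next
    case (step c c\<^sub>1)
    then show ?case
      by (metis converse_rtranclp_into_rtranclp topples_diamond)
  qed
  from assms(3) show ?thesis
    by (induction rule: rtranclp_induct) (use assms(1) one in blast)+
qed

lemma stabilization_eqI:
  assumes "(topples G s)\<^sup>*\<^sup>* c x" "stable G s x"
  shows "stabilization G s c = x"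
  unfolding stabilization_def
  using assms by (blast intro: the_equality dest: topples_stable_confluent stable_rtranclp_topples)

lemma topples_stabilization: "(topples G s)\<^sup>*\<^sup>* c (stabilization G s c)"
  and stable_stabilization: "stable G s (stabilization G s c)"
  using stabilizes[of c] stabilization_eqI by metis+

lemma stabilization_stable: "stable G s c \<Longrightarrow> stabilization G s c = c"
  by (blast intro: stabilization_eqI)

lemma stabilization_topples:
  assumes "(topples G s)\<^sup>*\<^sup>* c c'"
  shows "stabilization G s c = stabilization G s c'"
  using assms topples_stabilization[of c'] stable_stabilization[of c']
  by (meson rtranclp_trans stabilization_eqI)

section \<open>Stabilization and addition\<close>

lemma config_add: "config G s c \<Longrightarrow> config G s d \<Longrightarrow> config G s (\<lambda>v. c v + d v)"
  by (simp add: config_def)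

lemma config_times: "config G s c \<Longrightarrow> config G s (\<lambda>v. k * c v)"
  by (simp add: config_def)

lemma config_pile: "v \<in> nonsink G s \<Longrightarrow> config G s (pile v k)"
  by (auto simp: config_def pile_def)

lemma config_topples: "(topples G s)\<^sup>*\<^sup>* c c' \<Longrightarrow> config G s c \<Longrightarrow> config G s c'"
  by (induction rule: rtranclp_induct) (auto simp: config_def topples_def topple_def)

lemma config_stabilization: "config G s c \<Longrightarrow> config G s (stabilization G s c)"
  using config_topples topples_stabilization by blast

lemma stabilization_in_monoid: "config G s c \<Longrightarrow> stabilization G s c \<in> sandpile_monoid G s"
  by (simp add: sandpile_monoid_def config_stabilization stable_stabilization)

text \<open>Extra grains keep every toppling legal. \<open>d\<close> has to vanish off the non-sink
  vertices because \<open>topple\<close> resets those values to 0.\<close>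

lemma topples_add:
  assumes "(topples G s)\<^sup>*\<^sup>* c c'" "config G s d"
  shows "(topples G s)\<^sup>*\<^sup>* (\<lambda>v. c v + d v) (\<lambda>v. c' v + d v)"
  using assms(1)
proof (induction rule: rtranclp_induct)
  case (step x y)
  then obtain v where v: "v \<in> nonsink G s" "out_degree G v \<le> x v" "y = topple G s v x"
    unfolding topples_def by blast
  have "(\<lambda>w. y w + d w) = topple G s v (\<lambda>w. x w + d w)"
    using v assms(2) by (auto simp: topple_def config_def fun_eq_iff)
  then have "topples G s (\<lambda>v. x v + d v) (\<lambda>v. y v + d v)"
    unfolding topples_def using v by (auto intro!: bexI[of _ v])
  then show ?case using step.IH by (rule rtranclp.rtrancl_into_rtrancl[rotated])
qed simp

text \<open>Stabilizing a summand early does not change the result; this takes the place of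
  associativity of \<open>sp_add\<close>.\<close>

lemma stabilization_add_stabilization:
  assumes "config G s d"
  shows "stabilization G s (\<lambda>v. stabilization G s c v + d v) = stabilization G s (\<lambda>v. c v + d v)"
  using stabilization_topples[OF topples_add[OF topples_stabilization assms]] by simp

lemma stabilization_add_stabilization2:
  assumes "config G s c" "config G s d"
  shows "stabilization G s (\<lambda>v. stabilization G s c v + stabilization G s d v)
    = stabilization G s (\<lambda>v. c v + d v)"
  using stabilization_add_stabilization[OF config_stabilization[OF assms(2)], of c]
    stabilization_add_stabilization[OF assms(1), of d]
  by (simp add: add.commute)

lemma multiples_eq_stabilization:
  assumes "a \<in> sandpile_monoid G s"
  shows "multiples G s a n = stabilization G s (\<lambda>v. Suc n * a v)"
proof (induction n)
  case 0
  then show ?case using assms by (simp add: sandpile_monoid_def stabilization_stable)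
next
  case (Suc n)
  then show ?case
    using stabilization_add_stabilization[of a "\<lambda>v. Suc n * a v"] assms
    by (simp add: sp_add_def sandpile_monoid_def add.commute)
qed

section \<open>Finiteness of the monoid and idempotent multiples\<close>

lemma finite_sandpile_monoid: "finite (sandpile_monoid G s)"
proof -
  let ?B = "{..card (arcs G)}"
  have "out_degree G v \<le> card (arcs G)" for v
    unfolding out_degree_def by (rule card_mono) (auto simp: out_arcs_def)
  then have "sandpile_monoid G s \<subseteq>
      {f. \<forall>x. (x \<in> nonsink G s \<longrightarrow> f x \<in> ?B) \<and> (x \<notin> nonsink G s \<longrightarrow> f x = 0)}"
    unfolding sandpile_monoid_def config_def stable_def
    by (auto intro: order.trans[OF less_imp_le])
  then show ?thesis
    by (rule finite_subset) (rule finite_set_of_finite_funs, simp_all add: finite_nonsink)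
qed

text \<open>In a finite monoid the multiples of an element are eventually periodic, and a multiple
  of the period beyond the preperiod gives an idempotent.\<close>

lemma idempotent_multiple_exists:
  assumes "a \<in> sandpile_monoid G s"
  shows "\<exists>n. sp_add G s (multiples G s a n) (multiples G s a n) = multiples G s a n"
proof -
  define f where "f k = stabilization G s (\<lambda>v. k * a v)" for k
  have a: "config G s a" using assms by (simp add: sandpile_monoid_def)
  have ka: "config G s (\<lambda>v. k * a v)" for k using a by (rule config_times)
  have f_add: "f (k + l) = stabilization G s (\<lambda>v. f k v + f l v)" for k l
    unfolding f_def by (simp add: stabilization_add_stabilization2[OF ka ka] distrib_right)
  have "range f \<subseteq> sandpile_monoid G s"
    unfolding f_def using ka stabilization_in_monoid by blast
  then have "\<not> inj f"
    using finite_sandpile_monoid finite_subset finite_imageD infinite_UNIV_nat by metis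
  then obtain i j where "i < j" "f i = f j"
    unfolding inj_def by (metis linorder_neqE_nat)
  then obtain p where p: "0 < p" "f i = f (i + p)"
    by (metis less_imp_add_positive)
  have period: "f (i + l + t * p) = f (i + l)" for l t
  proof (induction t)
    case (Suc t)
    have "f (i + l + Suc t * p) = f ((i + p) + (l + t * p))" by (simp add: algebra_simps)
    also have "\<dots> = f (i + (l + t * p))" by (metis f_add p(2))
    finally show ?case using Suc by (simp add: algebra_simps)
  qed simp
  \<comment> \<open>A multiple of the period \<open>p\<close> that exceeds the preperiod
    \<open>i\<close>: \<open>N + N\<close> lies \<open>Suc i\<close> periods after
    \<open>N\<close>.\<close>
  define N where "N = Suc i * p"
  have "i < N" unfolding N_def using p(1) by (cases p) auto
  then have "f (N + N) = f N"
    using period[of "N - i" "Suc i"] by (simp add: N_def)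
  moreover obtain n where "N = Suc n" using \<open>i < N\<close> by (cases N) auto
  ultimately show ?thesis
    unfolding multiples_eq_stabilization[OF assms] sp_add_def f_def[symmetric] f_add by metis
qed

subsection \<open>Configurations dividing an idempotent\<close>

text \<open>Divisibility with unstable divisors and cofactors allowed, so that grains can be split
  off, added and toppled without stabilizing in between.\<close>

definition config_dvd :: "('v \<Rightarrow> nat) \<Rightarrow> ('v \<Rightarrow> nat) \<Rightarrow> bool" where
  "config_dvd c e \<longleftrightarrow>
     config G s c \<and> (\<exists>y. config G s y \<and> stabilization G s (\<lambda>v. c v + y v) = e)"

lemma config_dvd_addD: "config_dvd (\<lambda>v. c v + d v) e \<Longrightarrow> config_dvd c e"
proof -
  assume "config_dvd (\<lambda>v. c v + d v) e"
  then obtain y where cd: "config G s (\<lambda>v. c v + d v)" and y: "config G s y"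
    and eq: "stabilization G s (\<lambda>v. (c v + d v) + y v) = e"
    unfolding config_dvd_def by blast
  have "config G s c" "config G s (\<lambda>v. d v + y v)"
    using cd y by (auto simp: config_def)
  moreover have "stabilization G s (\<lambda>v. c v + (d v + y v)) = e"
    using eq by (simp add: add.assoc)
  ultimately show "config_dvd c e" unfolding config_dvd_def by blast
qed

lemma config_dvd_mono:
  assumes "config_dvd d e" "\<And>v. c v \<le> d v"
  shows "config_dvd c e"
  using assms config_dvd_addD[of c "\<lambda>v. d v - c v" e] by simp

text \<open>Adding the same cofactor to \<open>c\<close> and \<open>c'\<close> yields equal
  stabilizations. The backward direction will undo topplings.\<close>

lemma config_dvd_topples_iff:
  assumes "config G s c" "(topples G s)\<^sup>*\<^sup>* c c'"
  shows "config_dvd c e \<longleftrightarrow> config_dvd c' e"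
  unfolding config_dvd_def using assms config_topples
    stabilization_topples[OF topples_add[OF assms(2)]] by metis

text \<open>Accessibility asks for a stable cofactor; stabilizing the one given by divisibility does
  not affect the sum.\<close>

lemma recurrentI_config_dvd:
  assumes "e \<in> sandpile_monoid G s" "\<And>b. config G s b \<Longrightarrow> config_dvd b e"
  shows "recurrent G s e"
  unfolding recurrent_def accessible_def
proof (intro conjI ballI)
  fix b assume "b \<in> sandpile_monoid G s"
  then have b: "config G s b" by (simp add: sandpile_monoid_def)
  then obtain y where y: "config G s y" "stabilization G s (\<lambda>v. b v + y v) = e"
    using assms(2) unfolding config_dvd_def by blast
  then have "sp_add G s b (stabilization G s y) = e"
    using stabilization_add_stabilization[OF b, of y] by (simp add: sp_add_def add.commute)
  then show "\<exists>x \<in> sandpile_monoid G s. sp_add G s b x = e"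
    using stabilization_in_monoid[OF y(1)] by blast
qed (fact assms(1))

text \<open>The sum of the two cofactors is a cofactor for \<open>e\<close> plus \<open>e\<close>,
  which is \<open>e\<close> by idempotence.\<close>

lemma config_dvd_add:
  assumes idem: "sp_add G s e e = e" and "config_dvd c e" "config_dvd d e"
  shows "config_dvd (\<lambda>v. c v + d v) e"
proof -
  obtain y z where y: "config G s c" "config G s y" "stabilization G s (\<lambda>v. c v + y v) = e"
    and z: "config G s d" "config G s z" "stabilization G s (\<lambda>v. d v + z v) = e"
    using assms(2,3) unfolding config_dvd_def by blast
  have "stabilization G s (\<lambda>v. (c v + y v) + (d v + z v)) = e"
    using stabilization_add_stabilization2[OF config_add[OF y(1,2)] config_add[OF z(1,2)]]
      y(3) z(3) idem by (simp add: sp_add_def)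
  then have "stabilization G s (\<lambda>v. (c v + d v) + (y v + z v)) = e" by (simp add: algebra_simps)
  then show ?thesis unfolding config_dvd_def using y z config_add by blast
qed

lemma config_dvd_zero:
  assumes "e \<in> sandpile_monoid G s"
  shows "config_dvd (\<lambda>v. 0) e"
  using assms unfolding config_dvd_def
  by (auto simp: sandpile_monoid_def config_def stabilization_stable intro!: exI[of _ e])

text \<open>Induction on the number of grains, taking off one grain at a time.\<close>

lemma config_dvd_of_piles:
  assumes e: "e \<in> sandpile_monoid G s" "sp_add G s e e = e"
    and "config G s b" "\<And>v. 0 < b v \<Longrightarrow> config_dvd (pile v 1) e"
  shows "config_dvd b e"
  using assms(3,4)
proof (induction "\<Sum>v \<in> nonsink G s. b v" arbitrary: b)
  case 0
  then have "b = (\<lambda>v. 0)" using finite_nonsink by (auto simp: config_def fun_eq_iff)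
  then show ?case using config_dvd_zero e(1) by simp
next
  case (Suc n)
  then obtain v where v: "v \<in> nonsink G s" "0 < b v"
    by (metis gr0I sum.neutral nat.distinct(1))
  define b' where "b' = b(v := b v - 1)"
  have b: "b = (\<lambda>w. b' w + pile v 1 w)" using v by (auto simp: b'_def pile_def)
  have "(\<Sum>w \<in> nonsink G s. b w) = (\<Sum>w \<in> nonsink G s. b' w) + 1"
    using v finite_nonsink by (subst b) (simp add: sum.distrib pile_def)
  then have "n = (\<Sum>w \<in> nonsink G s. b' w)" using Suc.hyps(2) by simp
  moreover have "config G s b'" using Suc.prems(1) v by (auto simp: config_def b'_def)
  moreover have "config_dvd (pile w 1) e" if "0 < b' w" for w
    using that Suc.prems(2)[of w] v by (auto simp: b'_def split: if_splits)
  ultimately have "config_dvd b' e" using Suc.hyps(1) by blast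
  then show ?case using config_dvd_add[OF e(2) _ Suc.prems(2)[OF v(2)]] b by metis
qed

lemma topple_pile:
  assumes "v \<in> nonsink G s"
  shows "(topples G s)\<^sup>*\<^sup>* (pile v (out_degree G v)) (\<lambda>w. if w \<in> nonsink G s then mult v w else 0)"
proof -
  have "(\<lambda>w. if w \<in> nonsink G s then mult v w else 0) = topple G s v (pile v (out_degree G v))"
    by (auto simp: topple_def pile_def fun_eq_iff)
  then show ?thesis unfolding topples_def using assms
    by (intro r_into_rtranclp) (auto simp: topples_def pile_def intro!: bexI[of _ v])
qed

lemma config_dvd_pile_out_degree_iff:
  assumes "v \<in> nonsink G s"
  shows "config_dvd (pile v (out_degree G v)) e \<longleftrightarrow>
    config_dvd (\<lambda>w. if w \<in> nonsink G s then mult v w else 0) e"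
  using config_dvd_topples_iff[OF config_pile topple_pile] assms by simp

lemma out_degree_pos: "v \<in> nonsink G s \<Longrightarrow> 0 < out_degree G v"
  using sink_distance_exists by (force simp: out_degree_def card_gt_0_iff)

text \<open>By idempotence out-degree many grains on \<open>v\<close> divide \<open>e\<close>, and
  toppling them leaves at least one on \<open>w\<close>.\<close>

lemma config_dvd_pile_successor:
  assumes e: "e \<in> sandpile_monoid G s" "sp_add G s e e = e"
    and v: "config_dvd (pile v 1) e" and vw: "v \<rightarrow>\<^bsub>sinkless G s\<^esub> w"
  shows "config_dvd (pile w 1) e"
proof -
  have vw': "v \<in> nonsink G s" "w \<in> nonsink G s" "0 < mult v w"
    using vw dominates_sinkless_iff by auto
  have "config_dvd (pile v (out_degree G v)) e"
    by (rule config_dvd_of_piles[OF e config_pile[OF vw'(1)]])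
      (use v in \<open>simp add: pile_def split: if_splits\<close>)
  then have "config_dvd (\<lambda>w. if w \<in> nonsink G s then mult v w else 0) e"
    using config_dvd_pile_out_degree_iff vw' by blast
  then show ?thesis by (rule config_dvd_mono) (use vw' in \<open>auto simp: pile_def\<close>)
qed

text \<open>The same toppling read backwards. If all arcs from \<open>v\<close> lead to the sink,
  the toppled pile is zero, which divides \<open>e\<close>; this starts the induction.\<close>

lemma config_dvd_pile_if_successors:
  assumes e: "e \<in> sandpile_monoid G s" "sp_add G s e e = e"
    and v: "v \<in> nonsink G s"
    and succ: "\<And>w. v \<rightarrow>\<^bsub>sinkless G s\<^esub> w \<Longrightarrow> config_dvd (pile w 1) e"
  shows "config_dvd (pile v 1) e"
proof -
  have "config_dvd (\<lambda>w. if w \<in> nonsink G s then mult v w else 0) e"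
    by (rule config_dvd_of_piles[OF e])
      (use v succ in \<open>auto simp: config_def dominates_sinkless_iff split: if_splits\<close>)
  then have "config_dvd (pile v (out_degree G v)) e"
    using config_dvd_pile_out_degree_iff v by blast
  then show ?thesis
    by (rule config_dvd_mono) (use out_degree_pos[OF v] in \<open>auto simp: pile_def\<close>)
qed

lemma recurrent_multiple_exists:
  assumes a: "a \<in> sandpile_monoid G s"
    and cyc: "\<And>v. v \<rightarrow>\<^sup>+\<^bsub>sinkless G s\<^esub> v \<Longrightarrow> v \<in> cl G s (supp G s a)"
  shows "\<exists>n. recurrent G s (multiples G s a n)"
proof -
  let ?C = "cl G s (supp G s a)"
  obtain n where idem: "sp_add G s (multiples G s a n) (multiples G s a n) = multiples G s a n"
    using idempotent_multiple_exists[OF a] by blast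
  define e where "e = multiples G s a n"
  have conf_a: "config G s a" using a by (simp add: sandpile_monoid_def)
  have e_eq: "e = stabilization G s (\<lambda>v. a v + n * a v)"
    unfolding e_def multiples_eq_stabilization[OF a] by simp
  then have e: "e \<in> sandpile_monoid G s" "sp_add G s e e = e"
    using idem stabilization_in_monoid config_add conf_a config_times by (auto simp: e_def)
  have dvd_a: "config_dvd a e"
    unfolding config_dvd_def using conf_a config_times e_eq by blast
  have supp: "config_dvd (pile w 1) e" if "w \<in> supp G s a" for w
    using dvd_a by (rule config_dvd_mono) (use that in \<open>auto simp: supp_def pile_def\<close>)
  have inC: "config_dvd (pile v 1) e" if "v \<in> ?C" for v
  proof -
    obtain w where "w \<in> supp G s a" "w \<rightarrow>\<^sup>*\<^bsub>sinkless G s\<^esub> v"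
      using \<open>v \<in> ?C\<close> unfolding cl_def by blast
    from this(2) show ?thesis
      by (induction rule: X.reachable_induct)
        (use supp \<open>w \<in> supp G s a\<close> config_dvd_pile_successor[OF e] in blast)+
  qed
  \<comment> \<open>Successors are smaller, and only vertices outside \<open>?C\<close> have
    predecessors under \<open>r\<close>. A closed chain would give a cycle through a vertex outside
    \<open>?C\<close>, so \<open>r\<close> is acyclic, and finiteness makes it well-founded.\<close>
  define r where "r = {(w, v). v \<rightarrow>\<^bsub>sinkless G s\<^esub> w \<and> v \<notin> ?C}"
  have "finite r"
    by (rule finite_subset[of _ "nonsink G s \<times> nonsink G s"])
      (auto simp: r_def dominates_sinkless_iff finite_nonsink)
  moreover have "acyclic r"
  proof (rule acyclicI, intro allI notI)
    fix v assume vv: "(v, v) \<in> r\<^sup>+"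
    \<comment> \<open>The last pair of the chain has \<open>v\<close> as its second
      component.\<close>
    have "v \<notin> ?C" using tranclD2[OF vv] by (auto simp: r_def)
    have "r\<inverse> \<subseteq> arcs_ends (sinkless G s)" by (auto simp: r_def)
    then have "v \<rightarrow>\<^sup>+\<^bsub>sinkless G s\<^esub> v"
      using vv trancl_mono by (metis converse_iff trancl_converse)
    then show False using cyc \<open>v \<notin> ?C\<close> by blast
  qed
  ultimately have "wf r" by (rule finite_acyclic_wf)
  have piles: "v \<in> nonsink G s \<Longrightarrow> config_dvd (pile v 1) e" for v
  proof (induction v rule: wf_induct_rule[OF \<open>wf r\<close>])
    case (1 v)
    then show ?case
      using inC config_dvd_pile_if_successors[OF e, of v] by (auto simp: r_def dominates_sinkless_iff)
  qed
  have "config_dvd b e" if "config G s b" for b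
    using that by (rule config_dvd_of_piles[OF e]) (use that piles in \<open>force simp: config_def\<close>)
  then have "recurrent G s e" using e(1) by (rule recurrentI_config_dvd[rotated])
  then show ?thesis unfolding e_def by blast
qed

subsection \<open>Grains trapped on a cycle\<close>

lemma cl_closed: "v \<in> cl G s W \<Longrightarrow> v \<rightarrow>\<^sup>*\<^bsub>sinkless G s\<^esub> w \<Longrightarrow> w \<in> cl G s W"
  unfolding cl_def using X.reachable_trans X.reachable_in_verts nonsink_eq_verts_sinkless by blast

text \<open>Grains travel along arcs only, and the closure contains the non-sink heads of all arcs
  that start in it.\<close>

lemma topples_vanish_off_cl:
  assumes "(topples G s)\<^sup>*\<^sup>* c c'" "\<And>v. v \<notin> cl G s W \<Longrightarrow> c v = 0" "v \<notin> cl G s W"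
  shows "c' v = 0"
  using assms(1,3)
proof (induction arbitrary: v rule: rtranclp_induct)
  case (step x y)
  then obtain u where u: "u \<in> nonsink G s" "out_degree G u \<le> x u" "y = topple G s u x"
    unfolding topples_def by blast
  \<comment> \<open>Out-degrees are positive, so a toppling vertex holds a grain.\<close>
  have "u \<in> cl G s W" using u step.IH[of u] out_degree_pos[of u] by force
  then have "v \<notin> nonsink G s \<or> mult u v = 0"
    using cl_closed[of u W v] dominates_sinkless_iff[of u v] u(1) step.prems X.reachable_adjI
    by blast
  then show ?case using step u \<open>u \<in> cl G s W\<close> by (auto simp: topple_def)
qed (use assms(2) in blast)

text \<open>
  A vertex that reaches the cycle through \<open>z\<close> has a successor that does, so its toppling
  passes a grain on to a vertex of the same kind.
\<close>

lemma topples_grain_trapped: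
  assumes z: "z \<rightarrow>\<^sup>+\<^bsub>sinkless G s\<^esub> z"
    and "(topples G s)\<^sup>*\<^sup>* c c'" "\<exists>v. v \<rightarrow>\<^sup>*\<^bsub>sinkless G s\<^esub> z \<and> 0 < c v"
  shows "\<exists>v. v \<rightarrow>\<^sup>*\<^bsub>sinkless G s\<^esub> z \<and> 0 < c' v"
  using assms(2,3)
proof (induction rule: rtranclp_induct)
  case (step x y)
  then obtain v where v: "v \<rightarrow>\<^sup>*\<^bsub>sinkless G s\<^esub> z" "0 < x v" by blast
  obtain u where u: "u \<in> nonsink G s" "y = topple G s u x"
    using step unfolding topples_def by blast
  show ?case
  proof (cases "u = v")
    case True
    have "v \<rightarrow>\<^sup>+\<^bsub>sinkless G s\<^esub> z" using v(1) z by (rule X.reachable_reachable1_trans)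
    then obtain w where w: "v \<rightarrow>\<^bsub>sinkless G s\<^esub> w" "w \<rightarrow>\<^sup>*\<^bsub>sinkless G s\<^esub> z"
      by (rule X.reachable1_first_step)
    then have "0 < y w" using u True by (auto simp: topple_def dominates_sinkless_iff)
    then show ?thesis using w by blast
  next
    case False
    have "v \<in> nonsink G s" using v(1) X.reachable_in_verts nonsink_eq_verts_sinkless by blast
    then have "0 < y v" using False v u by (auto simp: topple_def)
    then show ?thesis using v by blast
  qed
qed

text \<open>Everything accessible from a stabilized grain on \<open>z\<close> keeps a grain on some
  vertex that reaches \<open>z\<close>, and no multiple of \<open>a\<close> has such a
  grain.\<close>

lemma multiples_not_recurrent:
  assumes a: "a \<in> sandpile_monoid G s"
    and z: "z \<rightarrow>\<^sup>+\<^bsub>sinkless G s\<^esub> z" "z \<notin> cl G s (supp G s a)"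
  shows "\<not> recurrent G s (multiples G s a n)"
proof
  let ?C = "cl G s (supp G s a)"
  \<comment> \<open>The single grain is itself unstable when \<open>z\<close> has out-degree 1,
    hence the stabilization.\<close>
  define b where "b = stabilization G s (pile z 1)"
  have zV: "z \<in> nonsink G s" using z(1) X.reachable1_in_verts nonsink_eq_verts_sinkless by blast
  then have zz: "z \<rightarrow>\<^sup>*\<^bsub>sinkless G s\<^esub> z" using X.reachable_refl nonsink_eq_verts_sinkless by simp
  have "b \<in> sandpile_monoid G s"
    unfolding b_def using zV by (intro stabilization_in_monoid config_pile)
  moreover assume "recurrent G s (multiples G s a n)"
  ultimately obtain x where x: "sp_add G s b x = multiples G s a n"
    unfolding recurrent_def accessible_def by blast
  have "\<exists>v. v \<rightarrow>\<^sup>*\<^bsub>sinkless G s\<^esub> z \<and> 0 < b v"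
    unfolding b_def
    by (rule topples_grain_trapped[OF z(1) topples_stabilization])
      (use zz in \<open>auto simp: pile_def\<close>)
  then have "\<exists>v. v \<rightarrow>\<^sup>*\<^bsub>sinkless G s\<^esub> z \<and> 0 < b v + x v" by auto
  then have "\<exists>v. v \<rightarrow>\<^sup>*\<^bsub>sinkless G s\<^esub> z \<and> 0 < sp_add G s b x v"
    unfolding sp_add_def by (rule topples_grain_trapped[OF z(1) topples_stabilization])
  then obtain v where v: "v \<rightarrow>\<^sup>*\<^bsub>sinkless G s\<^esub> z" "0 < multiples G s a n v"
    unfolding x by blast
  \<comment> \<open>The closure is closed under reachability, so a vertex of it could not reach
    \<open>z\<close> outside.\<close>
  have "v \<notin> ?C" using cl_closed v(1) z(2) by blast
  have "Suc n * a w = 0" if "w \<notin> ?C" for w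
  proof -
    have "w \<notin> supp G s a"
      using that X.reachable_refl unfolding cl_def supp_def nonsink_eq_verts_sinkless by blast
    then show ?thesis using a by (auto simp: supp_def sandpile_monoid_def config_def)
  qed
  then have "multiples G s a n v = 0"
    unfolding multiples_eq_stabilization[OF a]
    using \<open>v \<notin> ?C\<close> by (rule topples_vanish_off_cl[OF topples_stabilization])
  then show False using v(2) by simp
qed

end

theorem theorem4p4:
  fixes G :: "('v, 'e) pre_digraph" and s :: 'v and a :: "'v \<Rightarrow> nat"
  assumes "sandpile_graph G s"
    and "a \<in> sandpile_monoid G s"
  shows "((\<forall>p. pre_digraph.cycle (sinkless G s) p \<longrightarrow>
              cycle_verts (sinkless G s) p \<subseteq> cl G s (supp G s a))
            \<longrightarrow> (\<exists>n. recurrent G s (multiples G s a n)))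
       \<and> ((\<exists>p. pre_digraph.cycle (sinkless G s) p \<and>
              \<not> contains_cycle (iota G s (supp G s a)) (sinkless G s) p)
            \<longrightarrow> (\<forall>n. \<not> recurrent G s (multiples G s a n)))"
proof -
  interpret sandpile_graph G s by (fact assms(1))
  interpret X: fin_digraph "sinkless G s" by (rule fin_digraph_del_vert)
  show ?thesis
  proof (intro conjI impI allI)
    assume "\<forall>p. X.cycle p \<longrightarrow> cycle_verts (sinkless G s) p \<subseteq> cl G s (supp G s a)"
    then show "\<exists>n. recurrent G s (multiples G s a n)"
      using recurrent_multiple_exists[OF assms(2)] X.reachable1_self_iff_cycle by blast
  next
    fix n
    assume "\<exists>p. X.cycle p \<and> \<not> contains_cycle (iota G s (supp G s a)) (sinkless G s) p"
    \<comment> \<open>A cycle is missing from \<open>iota\<close> exactly when one of its vertices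
      is outside the closure.\<close>
    then obtain p z where "X.cycle p" "z \<in> cycle_verts (sinkless G s) p" "z \<notin> cl G s (supp G s a)"
      using iota_contains_cycle_iff by blast
    then show "\<not> recurrent G s (multiples G s a n)"
      using multiples_not_recurrent[OF assms(2)] X.reachable1_self_iff_cycle by blast
  qed
qed

end
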